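(* All quasi-crystallographs (without connected components of bipartite type $\mathcal{G}^{d_1,d_2}$) are disjoint unions of bichromatic graphs of type $A_n$, $B_n$, $C_n$, $D_n$, $BC_n$, $B_{r+s}C_r$ or $C_rD_{r+s}$, for integers $n,r,s\geq0$.
   Context: Bichromatic graphs: finite set of nodes, unoriented straight edges $\{i,j\}$ ($i\ne j$) and loop edges $\{k\}$, each coloured red or green, such that two distinct edges with the same underlying node set have different colours. Quasi-crystallograph: a bichromatic graph such that: (1) for any three distinct nodes $i,j,k$, if there are straight edges $\{i,j\}$, $\{j,k\}$ then there is a straight edge $\{i,k\}$, red if the first two have the same colour and green otherwise; (2) if a node $i$ is incident to a red loop edge and to a straight edge $\{i,j\}$, then both the red and the green straight edge $\{i,j\}$ are present, as well as a red loop edge at $j$; (3) if a node $i$ is incident to a green loop edge and to a straight edge $\{i,j\}$, then both the red and the green straight edge $\{i,j\}$ are present. Bipartite type $\mathcal{G}^{d_1,d_2}$ ($d_1,d_2\ge1$): graph without loops on $I_1\sqcup I_2$, $|I_i|=d_i$, whose red edges are exactly all pairs of distinct nodes in the same part and whose green edges are exactly all pairs of nodes in different parts. Types of bichromatic graphs: $A_{m-1}$ is the graph on $m\ge1$ nodes with exactly all red straight edges; $D_m$ is the graph on $m$ nodes with exactly all red and green straight edges and no loops; $B_m$ (resp. $C_m$, $BC_m$) is obtained from $D_m$ by adding a red (resp. a green, resp. both a red and a green) loop at every node. Type $B_{r+s}C_r$ is obtained from the graph of type $B_{r+s}$ by adding green loop edges at $r$ of the $r+s$ nodes; type $C_rD_{r+s}$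 is obtained from the graph of type $D_{r+s}$ by adding green loop edges at $r$ of the $r+s$ nodes. *)

theory Defs
  imports Main
begin

datatype colour = Red | Green

text \<open>
  An edge is its set of end nodes (two nodes for a straight edge, one for a loop) together with
  its colour. As the edges form a set of such pairs, two distinct edges with the same underlying
  node set automatically have different colours.
\<close>

record 'a bigraph =
  nodes :: "'a set"
  edges :: "('a set \<times> colour) set"

definition bichromatic_graph :: "'a bigraph \<Rightarrow> bool" where
  "bichromatic_graph G \<longleftrightarrow>
     finite (nodes G) \<and>
     (\<forall>(e, c) \<in> edges G. e \<subseteq> nodes G \<and> (card e = 1 \<or> card e = 2))"

definition straight :: "'a bigraph \<Rightarrow> colour \<Rightarrow> 'a \<Rightarrow> 'a \<Rightarrow> bool" where
  "straight G c i j \<longleftrightarrow> i \<noteq> j \<and> ({i, j}, c) \<in> edges G"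

definition loop :: "'a bigraph \<Rightarrow> colour \<Rightarrow> 'a \<Rightarrow> bool" where
  "loop G c k \<longleftrightarrow> ({k}, c) \<in> edges G"

definition quasi_crystallograph :: "'a bigraph \<Rightarrow> bool" where
  "quasi_crystallograph G \<longleftrightarrow>
     bichromatic_graph G \<and>
     (\<forall>i j k c d. i \<noteq> j \<and> j \<noteq> k \<and> i \<noteq> k \<and> straight G c i j \<and> straight G d j k \<longrightarrow>
        straight G (if c = d then Red else Green) i k) \<and>
     (\<forall>i j c. loop G Red i \<and> straight G c i j \<longrightarrow>
        straight G Red i j \<and> straight G Green i j \<and> loop G Red j) \<and>
     (\<forall>i j c. loop G Green i \<and> straight G c i j \<longrightarrow>
        straight G Red i j \<and> straight G Green i j)"

definition connected_rel :: "'a bigraph \<Rightarrow> ('a \<times> 'a) set" where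
  "connected_rel G = {(u, v). \<exists>c. straight G c u v}\<^sup>* \<inter> nodes G \<times> nodes G"

definition induced_subgraph :: "'a bigraph \<Rightarrow> 'a set \<Rightarrow> 'a bigraph" where
  "induced_subgraph G W = \<lparr>nodes = W, edges = {(e, c) \<in> edges G. e \<subseteq> W}\<rparr>"

definition connected_components :: "'a bigraph \<Rightarrow> 'a bigraph set" where
  "connected_components G = induced_subgraph G ` (nodes G // connected_rel G)"

definition bipartite_type :: "nat \<Rightarrow> nat \<Rightarrow> 'a bigraph \<Rightarrow> bool" where
  "bipartite_type d1 d2 G \<longleftrightarrow>
     (\<exists>I1 I2. finite I1 \<and> finite I2 \<and> I1 \<inter> I2 = {} \<and> card I1 = d1 \<and> card I2 = d2 \<and>
        nodes G = I1 \<union> I2 \<and>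
        edges G = {({i, j}, Red) | i j. i \<noteq> j \<and> (i \<in> I1 \<and> j \<in> I1 \<or> i \<in> I2 \<and> j \<in> I2)}
                \<union> {({i, j}, Green) | i j. i \<in> I1 \<and> j \<in> I2})"

definition all_straight :: "colour \<Rightarrow> 'a set \<Rightarrow> ('a set \<times> colour) set" where
  "all_straight c V = {({i, j}, c) | i j. i \<in> V \<and> j \<in> V \<and> i \<noteq> j}"

definition add_loops :: "colour \<Rightarrow> 'a set \<Rightarrow> 'a bigraph \<Rightarrow> 'a bigraph" where
  "add_loops c W G = \<lparr>nodes = nodes G, edges = edges G \<union> {({k}, c) | k. k \<in> W}\<rparr>"

text \<open>\<open>type_X n G\<close> means that \<open>G\<close> is the graph of type \<open>X\<^sub>n\<close> on some set of nodes.
  Note that \<open>A\<^sub>n\<close> has \<open>n + 1\<close> nodes, while the other types of index \<open>n\<close> have \<open>n\<close> nodes.\<close>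

definition type_A :: "nat \<Rightarrow> 'a bigraph \<Rightarrow> bool" where
  "type_A n G \<longleftrightarrow>
     finite (nodes G) \<and> card (nodes G) = n + 1 \<and> edges G = all_straight Red (nodes G)"

definition type_D :: "nat \<Rightarrow> 'a bigraph \<Rightarrow> bool" where
  "type_D n G \<longleftrightarrow>
     finite (nodes G) \<and> card (nodes G) = n \<and>
     edges G = all_straight Red (nodes G) \<union> all_straight Green (nodes G)"

definition type_B :: "nat \<Rightarrow> 'a bigraph \<Rightarrow> bool" where
  "type_B n G \<longleftrightarrow> (\<exists>H. type_D n H \<and> G = add_loops Red (nodes H) H)"

definition type_C :: "nat \<Rightarrow> 'a bigraph \<Rightarrow> bool" where
  "type_C n G \<longleftrightarrow> (\<exists>H. type_D n H \<and> G = add_loops Green (nodes H) H)"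

definition type_BC :: "nat \<Rightarrow> 'a bigraph \<Rightarrow> bool" where
  "type_BC n G \<longleftrightarrow>
     (\<exists>H. type_D n H \<and> G = add_loops Green (nodes H) (add_loops Red (nodes H) H))"

text \<open>The types \<open>B\<^bsub>r+s\<^esub>C\<^sub>r\<close> and \<open>C\<^sub>rD\<^bsub>r+s\<^esub>\<close>.\<close>

definition type_B_C :: "nat \<Rightarrow> nat \<Rightarrow> 'a bigraph \<Rightarrow> bool" where
  "type_B_C r s G \<longleftrightarrow>
     (\<exists>H R. type_B (r + s) H \<and> R \<subseteq> nodes H \<and> card R = r \<and> G = add_loops Green R H)"

definition type_C_D :: "nat \<Rightarrow> nat \<Rightarrow> 'a bigraph \<Rightarrow> bool" where
  "type_C_D r s G \<longleftrightarrow>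
     (\<exists>H R. type_D (r + s) H \<and> R \<subseteq> nodes H \<and> card R = r \<and> G = add_loops Green R H)"

definition is_disjoint_union :: "'a bigraph \<Rightarrow> 'a bigraph set \<Rightarrow> bool" where
  "is_disjoint_union G \<H> \<longleftrightarrow>
     finite \<H> \<and>
     pairwise (\<lambda>H K. disjnt (nodes H) (nodes K)) \<H> \<and>
     nodes G = (\<Union>H\<in>\<H>. nodes H) \<and>
     edges G = (\<Union>H\<in>\<H>. edges H)"

end

theory Submission
  imports Defs
begin

text \<open>
  The composition rule (two straight edges \<open>{i, j}\<close>, \<open>{j, k}\<close> force an edge \<open>{i, k}\<close>) shortens
  every path to a single edge, so any two distinct nodes of a connected component are joined
  (\<open>connected_rel_adjacent\<close>). The graph is the disjoint union of its connected components
  (\<open>disjoint_union_connected_components\<close>), and a component is determined by the colours of its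
  straight edges and by its loops (\<open>edges_induced_subgraph\<close>). Two cases are possible.

  If one pair of nodes carries both colours, composition with that pair gives both colours to
  every pair (\<open>double_edge_spreads\<close>). The straight edges are then those of type \<open>D\<close>; a red loop
  propagates to every node, whereas the green loops may sit at an arbitrary subset of \<open>r\<close> nodes.
  This is type \<open>B\<^bsub>r+s\<^esub>C\<^sub>r\<close> or \<open>C\<^sub>rD\<^bsub>r+s\<^esub>\<close>, according to whether there are red loops; for
  \<open>r = 0\<close> or \<open>s = 0\<close> these include the types \<open>B\<close>, \<open>C\<close>, \<open>D\<close> and \<open>BC\<close>
  (\<open>double_component_type\<close>). A component with a single node, with or without loops, has one of
  the same two types.

  If a component has at least two nodes and every pair carries exactly one colour, there are no
  loops, as each of them would meet a straight edge and double it. With red read as \<open>+1\<close>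
  and green as \<open>-1\<close>, the composition rule says that the product of the signs around each triangle
  is \<open>+1\<close>: red adjacency is an equivalence relation with at most two classes. One class
  is type \<open>A\<close>, and two classes are the bipartite type, which is excluded
  (\<open>simple_component_type\<close>).
\<close>

section \<open>Connected components\<close>

lemma straight_commute: "straight G c i j \<longleftrightarrow> straight G c j i"
  by (auto simp: straight_def insert_commute)

lemma straight_in_nodes:
  assumes "bichromatic_graph G" "straight G c i j"
  shows "i \<in> nodes G" "j \<in> nodes G"
  using assms by (auto simp: bichromatic_graph_def straight_def)

lemma straight_compose:
  assumes "quasi_crystallograph G" "straight G c i j" "straight G d j k" "i \<noteq> k"
  shows "straight G (if c = d then Red else Green) i k"
proof -
  have "i \<noteq> j" "j \<noteq> k"
    using assms by (auto simp: straight_def)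
  then show ?thesis
    using assms unfolding quasi_crystallograph_def by blast
qed

lemma connected_rel_adjacent:
  assumes "quasi_crystallograph G" "(u, v) \<in> connected_rel G" "u \<noteq> v"
  shows "\<exists>c. straight G c u v"
proof -
  have "(u, v) \<in> {(u, v). \<exists>c. straight G c u v}\<^sup>*"
    using assms by (auto simp: connected_rel_def)
  then have "u = v \<or> (\<exists>c. straight G c u v)"
  proof induction
    case base
    then show ?case by simp
  next
    case (step v w)
    then show ?case
      using straight_compose[OF assms(1), of _ u v _ w] by auto
  qed
  with assms(3) show ?thesis by simp
qed

lemma equiv_connected_rel: "equiv (nodes G) (connected_rel G)"
proof (rule equivI)
  have "sym {(u, v). \<exists>c. straight G c u v}"
    by (auto simp: sym_def straight_commute)
  then have "sym ({(u, v). \<exists>c. straight G c u v}\<^sup>*)"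
    by (rule sym_rtrancl)
  then show "sym (connected_rel G)"
    by (auto simp: connected_rel_def sym_def)
  show "trans (connected_rel G)"
    by (auto simp: connected_rel_def trans_def)
qed (auto simp: connected_rel_def refl_on_def)

lemma nodes_induced_subgraph [simp]: "nodes (induced_subgraph G W) = W"
  by (simp add: induced_subgraph_def)

lemma edge_cases:
  assumes "bichromatic_graph G" "(e, c) \<in> edges G"
  obtains (straight) i j where "e = {i, j}" "straight G c i j"
  | (loop) k where "e = {k}" "loop G c k"
proof -
  have "card e = 1 \<or> card e = 2"
    using assms by (auto simp: bichromatic_graph_def)
  then show ?thesis
  proof
    assume "card e = 1"
    then show ?thesis
      using that(2) assms by (auto simp: card_1_singleton_iff loop_def)
  next
    assume "card e = 2"
    then show ?thesis
      using that(1) assms by (auto simp: card_2_iff straight_def)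
  qed
qed

lemma disjoint_union_connected_components:
  assumes "bichromatic_graph G"
  shows "is_disjoint_union G (connected_components G)"
proof -
  note eqv = equiv_connected_rel[of G]
  have "finite (nodes G // connected_rel G)"
    using assms by (auto simp: bichromatic_graph_def connected_rel_def intro!: finite_quotient)
  then have fin: "finite (connected_components G)"
    by (simp add: connected_components_def)
  have disj: "pairwise (\<lambda>H K. disjnt (nodes H) (nodes K)) (connected_components G)"
    unfolding connected_components_def pairwise_def disjnt_def
    using quotient_disj[OF eqv] by fastforce
  have nodes: "nodes G = (\<Union>H\<in>connected_components G. nodes H)"
    unfolding connected_components_def using Union_quotient[OF eqv] by simp
  have "\<exists>W \<in> nodes G // connected_rel G. e \<subseteq> W" if "(e, c) \<in> edges G" for e c
  proof -
    from assms that show ?thesis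
    proof (cases rule: edge_cases)
      case (straight i j)
      then have "(i, j) \<in> connected_rel G" "(i, i) \<in> connected_rel G" "i \<in> nodes G"
        using straight_in_nodes[OF assms straight(2)] by (auto simp: connected_rel_def)
      then show ?thesis
        using straight(1) by (intro bexI[of _ "connected_rel G `` {i}"]) (auto intro: quotientI)
    next
      case (loop k)
      then have "k \<in> nodes G"
        using that assms by (auto simp: bichromatic_graph_def)
      then show ?thesis
        using loop(1) Union_quotient[OF eqv] by auto
    qed
  qed
  then have "edges G = (\<Union>W \<in> nodes G // connected_rel G. {(e, c) \<in> edges G. e \<subseteq> W})"
    by auto
  then have edges: "edges G = (\<Union>H\<in>connected_components G. edges H)"
    by (simp add: connected_components_def induced_subgraph_def)
  show ?thesis
    unfolding is_disjoint_union_def using fin disj nodes edges by blast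
qed

section \<open>Components in which all pairs of nodes are joined\<close>

text \<open>Reduces the identification of a component to its straight edges and its loops.\<close>

lemma edges_induced_subgraph:
  assumes "bichromatic_graph G"
  shows "edges (induced_subgraph G W) =
    {({i, j}, c) | i j c. i \<in> W \<and> j \<in> W \<and> straight G c i j} \<union>
    {({k}, c) | k c. k \<in> W \<and> loop G c k}" (is "_ = ?S \<union> ?L")
proof
  show "edges (induced_subgraph G W) \<subseteq> ?S \<union> ?L"
  proof
    fix p assume "p \<in> edges (induced_subgraph G W)"
    then obtain e c where p: "p = (e, c)" and e: "(e, c) \<in> edges G" "e \<subseteq> W"
      by (auto simp: induced_subgraph_def)
    from assms e(1) show "p \<in> ?S \<union> ?L"
    proof (cases rule: edge_cases)
      case (straight i j)
      then show ?thesis using p e(2) by blast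
    next
      case (loop k)
      then show ?thesis using p e(2) by blast
    qed
  qed
  show "?S \<union> ?L \<subseteq> edges (induced_subgraph G W)"
    by (auto simp: induced_subgraph_def straight_def loop_def)
qed

text \<open>Passing through \<open>i\<close> or \<open>j\<close> with the colour of choice on \<open>{i, j}\<close> realises both colours:
  first on each edge at \<open>i\<close>, and then, composing two edges at \<open>i\<close>, on every edge.\<close>

lemma double_edge_spreads:
  assumes qc: "quasi_crystallograph G"
    and joined: "\<And>u v. u \<in> W \<Longrightarrow> v \<in> W \<Longrightarrow> u \<noteq> v \<Longrightarrow> \<exists>c. straight G c u v"
    and ij: "i \<in> W" "j \<in> W" "straight G Red i j" "straight G Green i j"
    and uv: "u \<in> W" "v \<in> W" "u \<noteq> v"
  shows "straight G c u v"
proof -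
  have neq: "i \<noteq> j" using ij by (simp add: straight_def)
  have ij': "straight G d i j" "straight G d j i" for d
    using ij straight_commute[of G] by (cases d; simp)+
  have at_i: "straight G d k i" if k: "k \<in> W" "k \<noteq> i" for k d
  proof (cases "k = j")
    case True
    then show ?thesis using ij' by simp
  next
    case False
    obtain b where b: "straight G b k i"
      using joined[OF k(1) ij(1) k(2)] by blast
    have kj: "straight G a k j" for a
      using straight_compose[OF qc b ij'(1)[of Red] False]
        straight_compose[OF qc b ij'(1)[of Green] False] by (cases a; cases b) auto
    show ?thesis
      using straight_compose[OF qc kj[of Red] ij'(2)[of d] k(2)]
      by (cases d) auto
  qed
  show ?thesis
  proof (cases "u = i \<or> v = i")
    case True
    then show ?thesis
      using at_i uv straight_commute[of G c] by metis
  next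
    case False
    then have "straight G Red u i" "straight G c i v"
      using at_i uv straight_commute[of G c] by metis+
    from straight_compose[OF qc this uv(3)] show ?thesis
      by (cases c) auto
  qed
qed

text \<open>The components of the first kind. A component with one node also belongs here,
  having no pair of distinct nodes at all.\<close>

lemma double_component_type:
  assumes qc: "quasi_crystallograph G"
    and W: "W \<subseteq> nodes G"
    and double: "\<And>c u v. u \<in> W \<Longrightarrow> v \<in> W \<Longrightarrow> u \<noteq> v \<Longrightarrow> straight G c u v"
  shows "\<exists>r s. type_B_C r s (induced_subgraph G W) \<or> type_C_D r s (induced_subgraph G W)"
proof -
  have bc: "bichromatic_graph G" using qc by (simp add: quasi_crystallograph_def)
  then have fin: "finite W"
    using W by (auto simp: bichromatic_graph_def intro: finite_subset)
  define R where "R = {k \<in> W. loop G Green k}"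
  define r where "r = card R"
  define s where "s = card W - r"
  define D where "D = \<lparr>nodes = W, edges = all_straight Red W \<union> all_straight Green W\<rparr>"
  have "r + s = card W"
    using fin by (simp add: r_def s_def R_def card_mono)
  then have D: "type_D (r + s) D"
    using fin by (simp add: type_D_def D_def)
  have S: "{({i, j}, c) | i j c. i \<in> W \<and> j \<in> W \<and> straight G c i j} =
      all_straight Red W \<union> all_straight Green W" (is "?L = ?R")
  proof
    show "?L \<subseteq> ?R"
    proof clarsimp
      fix i j c
      assume "i \<in> W" "j \<in> W" "straight G c i j"
        and "({i, j}, c) \<notin> all_straight Green W"
      then show "({i, j}, c) \<in> all_straight Red W"
        unfolding all_straight_def straight_def by (cases c) blast+
    qed
    show "?R \<subseteq> ?L"
      using double unfolding all_straight_def by blast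
  qed
  show ?thesis
  proof (cases "\<exists>k\<in>W. loop G Red k")
    case True
    then obtain k where k: "k \<in> W" "loop G Red k" by blast
    have red: "loop G Red l" if "l \<in> W" for l
    proof (cases "l = k")
      case False
      then have "straight G Red k l" using double k that by simp
      with k(2) show ?thesis using qc unfolding quasi_crystallograph_def by blast
    qed (use k in simp)
    have "{({k}, c) | k c. k \<in> W \<and> loop G c k} =
        {({k}, Red) | k. k \<in> W} \<union> {({k}, Green) | k. k \<in> R}"
      using red by (auto simp: R_def) (metis colour.exhaust)+
    then have "edges (induced_subgraph G W) = edges (add_loops Green R (add_loops Red W D))"
      unfolding edges_induced_subgraph[OF bc] S by (simp add: add_loops_def D_def Un_assoc)
    then have "induced_subgraph G W = add_loops Green R (add_loops Red W D)"
      by (intro bigraph.equality) (simp_all add: add_loops_def D_def)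
    moreover have "type_B (r + s) (add_loops Red W D)"
      using D unfolding type_B_def by (intro exI[of _ D]) (simp add: D_def)
    moreover have "R \<subseteq> nodes (add_loops Red W D)"
      by (auto simp: add_loops_def D_def R_def)
    ultimately show ?thesis
      unfolding type_B_C_def r_def by blast
  next
    case False
    then have "{({k}, c) | k c. k \<in> W \<and> loop G c k} = {({k}, Green) | k. k \<in> R}"
      by (auto simp: R_def) (metis colour.exhaust)+
    then have "edges (induced_subgraph G W) = edges (add_loops Green R D)"
      unfolding edges_induced_subgraph[OF bc] S by (simp add: add_loops_def D_def)
    then have "induced_subgraph G W = add_loops Green R D"
      by (intro bigraph.equality) (simp_all add: add_loops_def D_def)
    moreover have "R \<subseteq> nodes D"
      by (auto simp: D_def R_def)
    ultimately show ?thesis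
      using D unfolding type_C_D_def r_def by blast
  qed
qed

text \<open>The components of the second kind. Fixing a node \<open>x\<close>, the nodes reached from \<open>x\<close> by red
  edges (with \<open>x\<close> itself) and those reached by green edges are the red classes, the second possibly empty: by composition
  at \<open>x\<close>, edges inside a part are red and edges between the parts are green.\<close>

lemma simple_component_type:
  assumes qc: "quasi_crystallograph G"
    and W: "W \<subseteq> nodes G"
    and joined: "\<And>u v. u \<in> W \<Longrightarrow> v \<in> W \<Longrightarrow> u \<noteq> v \<Longrightarrow> \<exists>c. straight G c u v"
    and simple: "\<And>u v. u \<in> W \<Longrightarrow> v \<in> W \<Longrightarrow> \<not> (straight G Red u v \<and> straight G Green u v)"
    and xy: "x \<in> W" "y \<in> W" "x \<noteq> y"
  shows "(\<exists>n. type_A n (induced_subgraph G W)) \<or>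
    (\<exists>d1\<ge>1. \<exists>d2\<ge>1. bipartite_type d1 d2 (induced_subgraph G W))"
proof -
  have bc: "bichromatic_graph G" using qc by (simp add: quasi_crystallograph_def)
  then have fin: "finite W"
    using W by (auto simp: bichromatic_graph_def intro: finite_subset)
  have no_loop: "\<not> loop G c k" if k: "k \<in> W" for c k
  proof
    assume loop: "loop G c k"
    obtain l where l: "l \<in> W" "l \<noteq> k" using xy by metis
    then obtain d where d: "straight G d k l" using joined k by metis
    have "straight G Red k l \<and> straight G Green k l"
      using qc loop d unfolding quasi_crystallograph_def by (cases c) blast+
    then show False using simple k l by blast
  qed
  then have E: "edges (induced_subgraph G W) =
      {({i, j}, c) | i j c. i \<in> W \<and> j \<in> W \<and> straight G c i j}"
    unfolding edges_induced_subgraph[OF bc] by blast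
  define I1 where "I1 = {k \<in> W. k = x \<or> straight G Red k x}"
  define I2 where "I2 = {k \<in> W. straight G Green k x}"
  have "straight G Red k x \<or> straight G Green k x" if "k \<in> W" "k \<noteq> x" for k
    using joined[OF that(1) xy(1) that(2)] by (metis colour.exhaust)
  then have un: "I1 \<union> I2 = W"
    unfolding I1_def I2_def by blast
  have int: "I1 \<inter> I2 = {}"
    using simple[OF _ xy(1)] by (auto simp: I1_def I2_def straight_def)
  have red1: "straight G Red i j" if "i \<in> I1" "j \<in> I1" "i \<noteq> j" for i j
    using that straight_compose[OF qc, of Red i x Red j] straight_commute[of G]
    unfolding I1_def by auto
  have red2: "straight G Red i j" if "i \<in> I2" "j \<in> I2" "i \<noteq> j" for i j
    using that straight_compose[OF qc, of Green i x Green j] straight_commute[of G]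
    unfolding I2_def by auto
  have green: "straight G Green i j" if "i \<in> I1" "j \<in> I2" for i j
  proof -
    have "i \<noteq> j" using that int by blast
    then show ?thesis
      using that straight_compose[OF qc, of Red i x Green j] straight_commute[of G]
      unfolding I1_def I2_def by auto
  qed
  have edges: "edges (induced_subgraph G W) =
      {({i, j}, Red) | i j. i \<noteq> j \<and> (i \<in> I1 \<and> j \<in> I1 \<or> i \<in> I2 \<and> j \<in> I2)}
      \<union> {({i, j}, Green) | i j. i \<in> I1 \<and> j \<in> I2}" (is "_ = ?R \<union> ?G")
  proof
    show "?R \<union> ?G \<subseteq> edges (induced_subgraph G W)"
      using red1 red2 green un unfolding E by blast
    show "edges (induced_subgraph G W) \<subseteq> ?R \<union> ?G"
    proof
      fix p assume "p \<in> edges (induced_subgraph G W)"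
      then obtain i j c where p: "p = ({i, j}, c)" and ij: "i \<in> W" "j \<in> W" "straight G c i j"
        unfolding E by blast
      have ne: "i \<noteq> j" using ij by (simp add: straight_def)
      show "p \<in> ?R \<union> ?G"
      proof (cases "i \<in> I1 \<and> j \<in> I1 \<or> i \<in> I2 \<and> j \<in> I2")
        case True
        then have "straight G Red i j" using red1 red2 ne by blast
        then have "c = Red" using simple ij by (cases c) blast+
        then show ?thesis using p ne True by blast
      next
        case False
        then have cross: "i \<in> I1 \<and> j \<in> I2 \<or> j \<in> I1 \<and> i \<in> I2"
          using un ij by blast
        then have "straight G Green i j"
          using green straight_commute[of G Green] by blast
        then have "c = Green" using simple ij by (cases c) blast+
        moreover have "{i, j} = {j, i}" by blast
        ultimately show ?thesis using p cross by blast
      qed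
    qed
  qed
  have fins: "finite I1" "finite I2" using fin un by auto
  show ?thesis
  proof (cases "I2 = {}")
    case True
    have "I1 = W" using un True by simp
    then have "edges (induced_subgraph G W) = all_straight Red W"
      unfolding edges True all_straight_def by blast
    moreover have "card W > 0"
      using fin xy(1) by (auto simp: card_gt_0_iff)
    ultimately have "type_A (card W - 1) (induced_subgraph G W)"
      using fin unfolding type_A_def by simp
    then show ?thesis by blast
  next
    case False
    have "x \<in> I1" using xy by (simp add: I1_def)
    then have "card I1 \<ge> 1" "card I2 \<ge> 1"
      using False fins by (auto simp: Suc_le_eq card_gt_0_iff)
    moreover have "bipartite_type (card I1) (card I2) (induced_subgraph G W)"
      unfolding bipartite_type_def
      using edges fins int un by (intro exI[of _ I1] exI[of _ I2]) simp
    ultimately show ?thesis by blast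
  qed
qed

section \<open>Classification\<close>

theorem corollary6p4p3:
  fixes G :: "'a bigraph"
  assumes "quasi_crystallograph G"
    and "\<not> (\<exists>H \<in> connected_components G. \<exists>d1 \<ge> 1. \<exists>d2 \<ge> 1. bipartite_type d1 d2 H)"
  shows "\<exists>\<H>. is_disjoint_union G \<H> \<and>
    (\<forall>H \<in> \<H>.
      (\<exists>n. type_A n H) \<or> (\<exists>n. type_B n H) \<or> (\<exists>n. type_C n H) \<or> (\<exists>n. type_D n H) \<or>
      (\<exists>n. type_BC n H) \<or> (\<exists>r s. type_B_C r s H) \<or> (\<exists>r s. type_C_D r s H))"
proof -
  have "(\<exists>n. type_A n H) \<or> (\<exists>r s. type_B_C r s H \<or> type_C_D r s H)"
    if H: "H \<in> connected_components G" for H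
  proof -
    obtain W where W: "W \<in> nodes G // connected_rel G" and HW: "H = induced_subgraph G W"
      using H unfolding connected_components_def by blast
    have sub: "W \<subseteq> nodes G"
      using in_quotient_imp_subset[OF equiv_connected_rel W] .
    have joined: "\<exists>c. straight G c u v" if "u \<in> W" "v \<in> W" "u \<noteq> v" for u v
      using connected_rel_adjacent[OF assms(1) _ that(3)]
        quotient_eq_iff[OF equiv_connected_rel W W that(1,2)] by simp
    show ?thesis
    proof (cases "\<exists>i\<in>W. \<exists>j\<in>W. i \<noteq> j \<and> \<not> (straight G Red i j \<and> straight G Green i j)")
      case True
      then obtain x y where xy: "x \<in> W" "y \<in> W" "x \<noteq> y"
        "\<not> (straight G Red x y \<and> straight G Green x y)" by blast
      have "\<not> (straight G Red u v \<and> straight G Green u v)" if "u \<in> W" "v \<in> W" for u v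
        using double_edge_spreads[OF assms(1) joined that _ _ xy(1-3)] xy(4) by blast
      from simple_component_type[OF assms(1) sub joined this xy(1-3)] show ?thesis
        using assms(2) H HW by blast
    next
      case False
      then have "straight G c u v" if "u \<in> W" "v \<in> W" "u \<noteq> v" for c u v
        using that by (cases c) blast+
      from double_component_type[OF assms(1) sub this] show ?thesis
        using HW by blast
    qed
  qed
  moreover have "is_disjoint_union G (connected_components G)"
    using disjoint_union_connected_components assms(1) unfolding quasi_crystallograph_def by blast
  ultimately show ?thesis by blast
qed

end
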